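(* Let $\mathcal{H}_1,\mathcal{H}_2$ be real or complex Hilbert spaces, $M\subseteq\mathcal{H}_1$ and $N\subseteq\mathcal{H}_2$ closed subspaces, and let $T\in\mathcal{B}(\mathcal{H}_1,\mathcal{H}_2)$ have block form $T=\begin{pmatrix}A&B\\C&D\end{pmatrix}$ with respect to $\mathcal{H}_1=M\oplus M^\perp$ and $\mathcal{H}_2=N\oplus N^\perp$. Let $\lambda>0$. If $T$ is $(M,N,\lambda)$-complementable, then $$\|T_{/(M,N)}\|\le\sqrt{1+\lambda^2}\,\|T|_L\|\quad\text{and}\quad\|T_{/(M,N)}\|\le\sqrt{1+\lambda^2}\,\|T\|,$$ where $L=\{(x,y)\in M\oplus M^\perp: Cx+Dy=0\}$ and $T|_L$ is the restriction of $T$ to $L$.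
   Context: $\mathcal{B}(\mathcal{H},\mathcal{K})$ is the space of bounded linear operators; $\mathcal{R}(\cdot)$ and $\mathcal{N}(\cdot)$ denote range and null space. Block entries: $A:M\to N$, $B:M^\perp\to N$, $C:M\to N^\perp$, $D:M^\perp\to N^\perp$, all bounded. For a closed subspace $W$, $\mathcal{B}_W=\{x\in W:\|x\|\le1\}$. For $\lambda>0$, $T$ is $(M,N,\lambda)$-complementable if $C(\mathcal{B}_M)\subseteq\lambda D(\mathcal{B}_{M^\perp})$ and $B^*(\mathcal{B}_N)\subseteq\lambda D^*(\mathcal{B}_{N^\perp})$; in particular $\mathcal{R}(C)\subseteq\mathcal{R}(D)$ and $\mathcal{R}(B^* )\subseteq\mathcal{R}(D^* )$. If $\mathcal{R}(A_1)\subseteq\mathcal{R}(B_1)$ for bounded operators $A_1,B_1$ with the same codomain, the Douglas reduced solution of $A_1=B_1X$ is the unique bounded $C_1$ with $A_1=B_1C_1$ and $\mathcal{R}(C_1)\subseteq\mathcal{N}(B_1)^\perp$. The Schur complement is $T_{/(M,N)}=\begin{pmatrix}A-BZ&0\\0&0\end{pmatrix}=\begin{pmatrix}A-YC&0\\0&0\end{pmatrix}$, where $Z$ is the Douglas reduced solution of $C=DX$ and $Y^*$ is the Douglas reduced solution of $B^*=D^*X$. *)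

theory Defs
  imports "HOL-Analysis.Analysis"
begin

text \<open>
  The scalar fields \<open>\<real>\<close> and \<open>\<complex>\<close>, treated uniformly. By \<open>real_or_complex\<close> below these are, up to
  isomorphism, the only models of the class.
\<close>

class rc_field = real_normed_field +
  fixes rc_conj :: "'a \<Rightarrow> 'a"
  assumes rc_conj_add: "rc_conj (x + y) = rc_conj x + rc_conj y"
    and rc_conj_mult: "rc_conj (x * y) = rc_conj x * rc_conj y"
    and mult_rc_conj_scaleR: "x * rc_conj x = (norm x)\<^sup>2 *\<^sub>R 1"

lemma mult_rc_conj: "x * rc_conj x = of_real ((norm x)\<^sup>2)" for x :: "'k::rc_field"
  by (simp only: mult_rc_conj_scaleR of_real_def)

instantiation real :: rc_field
begin
definition rc_conj_real :: "real \<Rightarrow> real" where "rc_conj_real x = x"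
instance by standard (auto simp: rc_conj_real_def power2_eq_square)
end

instantiation complex :: rc_field
begin
definition rc_conj_complex :: "complex \<Rightarrow> complex" where "rc_conj_complex = cnj"
instance by standard (simp_all add: rc_conj_complex_def scaleR_conv_of_real flip: complex_norm_square)
end

lemma real_or_complex:
  "(UNIV :: 'k::rc_field set) = \<real> \<or>
   (\<exists>i::'k. i * i = -1 \<and> rc_conj i = - i \<and> (\<forall>z. \<exists>a b. z = of_real a + of_real b * i))"
proof -
  have conj0: "rc_conj 0 = (0::'k)"
    using rc_conj_add[of 0 "0::'k"] by simp
  have conj1: "rc_conj 1 = (1::'k)"
    using mult_rc_conj[of "1::'k"] by simp
  have conj_real: "rc_conj (of_real r) = (of_real r :: 'k)" for r
  proof (cases "r = 0")
    case False
    have "of_real r * rc_conj (of_real r :: 'k) = of_real r * of_real r"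
      using mult_rc_conj[of "of_real r :: 'k"] by (simp add: power2_eq_square flip: of_real_mult)
    with False show ?thesis by simp
  qed (simp add: conj0)
  have trace: "\<exists>t. x + rc_conj x = of_real t" for x :: 'k
  proof -
    have "(x + 1) * rc_conj (x + 1) = x * rc_conj x + (x + rc_conj x) + 1"
      by (simp add: rc_conj_add conj1 algebra_simps)
    then have "x + rc_conj x = of_real ((norm (x + 1))\<^sup>2 - (norm x)\<^sup>2 - 1)"
      unfolding mult_rc_conj by (simp add: algebra_simps)
    then show ?thesis by blast
  qed
  have self: "\<exists>t. x = of_real t" if "rc_conj x = x" for x :: 'k
  proof -
    obtain t where "x + x = of_real t" using trace[of x] \<open>rc_conj x = x\<close> by auto
    then have "2 * x = of_real t" by simp
    then have "x = of_real (t / 2)" by (simp add: field_simps)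
    then show ?thesis by blast
  qed
  have split: "\<exists>a w. x = of_real a + w \<and> rc_conj w = - w" for x :: 'k
  proof -
    obtain t where t: "x + rc_conj x = of_real t" using trace by blast
    define w where "w = x - of_real (t / 2)"
    have x: "x = w + of_real (t / 2)" by (simp add: w_def)
    have "rc_conj x = rc_conj w + of_real (t / 2)"
      by (subst x, simp only: rc_conj_add conj_real)
    then have "w + rc_conj w = x + rc_conj x - (of_real (t / 2) + of_real (t / 2))"
      by (simp only: w_def) (simp add: algebra_simps)
    also have "of_real (t / 2) + of_real (t / 2) = (of_real t :: 'k)"
      by (simp only: of_real_add[symmetric] field_sum_of_halves)
    finally have "w + rc_conj w = x + rc_conj x - of_real t" .
    then have "rc_conj w = - w" using t by (simp add: eq_neg_iff_add_eq_0 add.commute)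
    then show ?thesis by (intro exI[of _ "t / 2"] exI[of _ w]) (simp add: w_def)
  qed
  show ?thesis
  proof (cases "(UNIV :: 'k set) = \<real>")
    case False
    then obtain x :: 'k where x: "x \<notin> \<real>" by blast
    obtain a w where w: "x = of_real a + w" "rc_conj w = - w" using split by blast
    have "w \<noteq> 0" using x w(1) by auto
    define i where "i = w / of_real (norm w)"
    have "i * of_real (norm w) = w" using \<open>w \<noteq> 0\<close> by (simp add: i_def)
    then have "rc_conj i * of_real (norm w) = - (i * of_real (norm w))"
      using w(2) rc_conj_mult[of i "of_real (norm w)"] by (simp add: conj_real)
    then have ci: "rc_conj i = - i" using \<open>w \<noteq> 0\<close>
      by (metis minus_mult_left mult_right_cancel norm_eq_zero of_real_eq_0_iff)
    have "norm i = 1" using \<open>w \<noteq> 0\<close> by (simp add: i_def norm_divide)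
    then have ii: "i * i = - 1" using mult_rc_conj[of i] ci
      by (metis minus_minus mult_minus_right of_real_1 one_power2)
    have "\<exists>a b. z = of_real a + of_real b * i" for z :: 'k
    proof -
      obtain a v where v: "z = of_real a + v" "rc_conj v = - v" using split by blast
      have "rc_conj (v * i) = v * i" by (simp add: rc_conj_mult v ci)
      then obtain t where t: "v * i = of_real t" using self by blast
      have "v = - (v * i) * i" using ii by (simp add: mult.assoc)
      then have "v = of_real (- t) * i" by (simp add: t)
      then show ?thesis using v(1) by blast
    qed
    then show ?thesis using ii ci by blast
  qed simp
qed

text \<open>
  Hilbert spaces over \<open>'k\<close>: completeness and the norm come from \<open>banach\<close>; the inner product is
  linear in its first argument.
\<close>

locale hilbert_space = vector_space smul
  for smul :: "'k::rc_field \<Rightarrow> 'a::banach \<Rightarrow> 'a" +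
  fixes ip :: "'a \<Rightarrow> 'a \<Rightarrow> 'k"
  assumes smul_of_real: "smul (of_real r) x = r *\<^sub>R x"
    and ip_add_left: "ip (x + y) z = ip x z + ip y z"
    and ip_smul_left: "ip (smul c x) y = c * ip x y"
    and ip_commute: "ip y x = rc_conj (ip x y)"
    and ip_self: "ip x x = of_real ((norm x)\<^sup>2)"

lemma hilbert_space_real:
  "hilbert_space scaleR (inner :: 'a::{real_inner,banach} \<Rightarrow> 'a \<Rightarrow> real)"
  by unfold_locales
    (auto simp: algebra_simps inner_commute rc_conj_real_def power2_norm_eq_inner)

lemma hilbert_space_complex: "hilbert_space (*) (\<lambda>x y. x * cnj y)"
  by unfold_locales
    (simp_all add: algebra_simps rc_conj_complex_def scaleR_conv_of_real flip: complex_norm_square)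

definition closed_subspace :: "('k::rc_field \<Rightarrow> 'a::banach \<Rightarrow> 'a) \<Rightarrow> 'a set \<Rightarrow> bool" where
  "closed_subspace smul W \<longleftrightarrow> module.subspace smul W \<and> closed W"

definition orth_compl :: "('a \<Rightarrow> 'a \<Rightarrow> 'k::rc_field) \<Rightarrow> 'a set \<Rightarrow> 'a set" where
  "orth_compl ip W = {y. \<forall>x\<in>W. ip x y = 0}"

definition orth_proj :: "('a::banach \<Rightarrow> 'a \<Rightarrow> 'k::rc_field) \<Rightarrow> 'a set \<Rightarrow> 'a \<Rightarrow> 'a" where
  "orth_proj ip W x = (THE p. p \<in> W \<and> x - p \<in> orth_compl ip W)"

definition unit_ball :: "'a::real_normed_vector set \<Rightarrow> 'a set" where
  "unit_ball W = {x \<in> W. norm x \<le> 1}"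

text \<open>
  Operators from a subspace \<open>W\<close> to a subspace \<open>V\<close> are extensional functions, i.e. \<open>undefined\<close>
  outside \<open>W\<close>, so that equality of functions is equality of operators. For \<open>W = V = UNIV\<close> this
  gives the bounded operators between the full spaces.
\<close>

definition bounded_ops ::
  "('k::rc_field \<Rightarrow> 'a::banach \<Rightarrow> 'a) \<Rightarrow> ('k \<Rightarrow> 'b::banach \<Rightarrow> 'b) \<Rightarrow> 'a set \<Rightarrow> 'b set \<Rightarrow> ('a \<Rightarrow> 'b) set"
  where
  "bounded_ops smul1 smul2 W V =
    {S \<in> W \<rightarrow>\<^sub>E V.
      (\<forall>x\<in>W. \<forall>y\<in>W. S (x + y) = S x + S y) \<and>
      (\<forall>c. \<forall>x\<in>W. S (smul1 c x) = smul2 c (S x)) \<and>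
      (\<exists>K. \<forall>x\<in>W. norm (S x) \<le> K * norm x)}"

lemma bounded_ops_UNIV:
  assumes "hilbert_space smul1 ip1" "hilbert_space smul2 ip2"
  shows "bounded_ops smul1 smul2 UNIV UNIV =
    {T. bounded_linear T \<and> Vector_Spaces.linear smul1 smul2 T}"
proof -
  interpret H1: hilbert_space smul1 ip1 by fact
  interpret H2: hilbert_space smul2 ip2 by fact
  have scaleR: "T (r *\<^sub>R x) = r *\<^sub>R T x"
    if "\<forall>c x. T (smul1 c x) = smul2 c (T x)" for T r x
    using that by (simp flip: H1.smul_of_real H2.smul_of_real)
  have lin: "Vector_Spaces.linear smul1 smul2 T \<longleftrightarrow>
      (\<forall>x y. T (x + y) = T x + T y) \<and> (\<forall>c x. T (smul1 c x) = smul2 c (T x))" for T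
    by (auto simp: Vector_Spaces.linear_def module_hom_def module_hom_axioms_def
        H1.vector_space_axioms H2.vector_space_axioms H1.module_axioms H2.module_axioms)
  have bnd: "bounded_linear T \<longleftrightarrow> (\<exists>K. \<forall>x. norm (T x) \<le> K * norm x)"
    if "Vector_Spaces.linear smul1 smul2 T" for T
  proof -
    have "linear T" using that scaleR unfolding lin by (auto intro: linearI)
    then show ?thesis
      by (simp add: bounded_linear_def bounded_linear_axioms_def mult.commute)
  qed
  have "T \<in> bounded_ops smul1 smul2 UNIV UNIV \<longleftrightarrow>
      bounded_linear T \<and> Vector_Spaces.linear smul1 smul2 T" for T
    using bnd[of T] lin[of T] by (auto simp: bounded_ops_def)
  then show ?thesis by blast
qed

definition op_block ::
  "('b::banach \<Rightarrow> 'b \<Rightarrow> 'k::rc_field) \<Rightarrow> 'a set \<Rightarrow> 'b set \<Rightarrow> ('a \<Rightarrow> 'b) \<Rightarrow> 'a \<Rightarrow> 'b" where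
  "op_block ip2 W V T = (\<lambda>x\<in>W. orth_proj ip2 V (T x))"

definition op_adjoint ::
  "('a \<Rightarrow> 'a \<Rightarrow> 'k::rc_field) \<Rightarrow> ('b \<Rightarrow> 'b \<Rightarrow> 'k) \<Rightarrow> 'a set \<Rightarrow> 'b set \<Rightarrow> ('a \<Rightarrow> 'b) \<Rightarrow> 'b \<Rightarrow> 'a" where
  "op_adjoint ip1 ip2 W V S =
    (\<lambda>y\<in>V. THE z. z \<in> W \<and> (\<forall>x\<in>W. ip2 (S x) y = ip1 x z))"

definition complementable ::
  "('a::banach \<Rightarrow> 'a \<Rightarrow> 'k::rc_field) \<Rightarrow> ('b::banach \<Rightarrow> 'b \<Rightarrow> 'k) \<Rightarrow>
    'a set \<Rightarrow> 'b set \<Rightarrow> real \<Rightarrow> ('a \<Rightarrow> 'b) \<Rightarrow> bool" where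
  "complementable ip1 ip2 M N l T \<longleftrightarrow>
    (let M' = orth_compl ip1 M; N' = orth_compl ip2 N;
         B = op_block ip2 M' N T; C = op_block ip2 M N' T; D = op_block ip2 M' N' T
     in C ` unit_ball M \<subseteq> (\<lambda>v. l *\<^sub>R v) ` D ` unit_ball M' \<and>
        op_adjoint ip1 ip2 M' N B ` unit_ball N \<subseteq>
          (\<lambda>v. l *\<^sub>R v) ` op_adjoint ip1 ip2 M' N' D ` unit_ball N')"

text \<open>
  The Douglas reduced solution of \<open>A = B X\<close> for operators \<open>A\<close> on \<open>U\<close> and \<open>B\<close> on \<open>W\<close> with the same
  codomain; the orthogonal complement of the kernel of \<open>B\<close> is taken inside the domain \<open>W\<close>.
\<close>

definition douglas_solution ::
  "('k::rc_field \<Rightarrow> 'u::banach \<Rightarrow> 'u) \<Rightarrow> ('k \<Rightarrow> 'w::banach \<Rightarrow> 'w) \<Rightarrow> ('w \<Rightarrow> 'w \<Rightarrow> 'k) \<Rightarrow>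
    'u set \<Rightarrow> 'w set \<Rightarrow> ('u \<Rightarrow> 'b::banach) \<Rightarrow> ('w \<Rightarrow> 'b) \<Rightarrow> 'u \<Rightarrow> 'w" where
  "douglas_solution smulU smulW ipW U W A B =
    (THE X. X \<in> bounded_ops smulU smulW U W \<and> (\<forall>x\<in>U. A x = B (X x)) \<and>
      X ` U \<subseteq> W \<inter> orth_compl ipW {z \<in> W. B z = 0})"

text \<open>
  \<open>A - B Z\<close> on \<open>M\<close>, extended by zero on the orthogonal complement of \<open>M\<close>. For complementable \<open>T\<close> this equals
  \<open>A - Y C\<close>, where \<open>Y\<close> is the adjoint of the Douglas reduced solution of the adjoint equation
  \<open>B\<^sup>* = D\<^sup>* X\<close>.
\<close>

definition schur_complement ::
  "('k::rc_field \<Rightarrow> 'a::banach \<Rightarrow> 'a) \<Rightarrow> ('a \<Rightarrow> 'a \<Rightarrow> 'k) \<Rightarrow> ('b::banach \<Rightarrow> 'b \<Rightarrow> 'k) \<Rightarrow>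
    'a set \<Rightarrow> 'b set \<Rightarrow> ('a \<Rightarrow> 'b) \<Rightarrow> 'a \<Rightarrow> 'b" where
  "schur_complement smul1 ip1 ip2 M N T =
    (let M' = orth_compl ip1 M; N' = orth_compl ip2 N;
         A = op_block ip2 M N T; B = op_block ip2 M' N T;
         C = op_block ip2 M N' T; D = op_block ip2 M' N' T;
         Z = douglas_solution smul1 smul1 ip1 M M' C D
     in (\<lambda>x. A (orth_proj ip1 M x) - B (Z (orth_proj ip1 M x))))"

definition row_kernel ::
  "('a::banach \<Rightarrow> 'a \<Rightarrow> 'k::rc_field) \<Rightarrow> ('b::banach \<Rightarrow> 'b \<Rightarrow> 'k) \<Rightarrow>
    'a set \<Rightarrow> 'b set \<Rightarrow> ('a \<Rightarrow> 'b) \<Rightarrow> 'a set" where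
  "row_kernel ip1 ip2 M N T =
    (let M' = orth_compl ip1 M; N' = orth_compl ip2 N;
         C = op_block ip2 M N' T; D = op_block ip2 M' N' T
     in {x + y | x y. x \<in> M \<and> y \<in> M' \<and> C x + D y = 0})"

text \<open>
  The norm of the restriction of \<open>T\<close> to a subspace, in the form used by \<open>onorm\<close>; the vector
  \<open>0\<close> contributes \<open>0 / 0 = 0\<close>.
\<close>

definition onorm_on :: "'a::real_normed_vector set \<Rightarrow> ('a \<Rightarrow> 'b::real_normed_vector) \<Rightarrow> real" where
  "onorm_on W T = (SUP x\<in>W. norm (T x) / norm x)"

lemma onorm_on_UNIV: "onorm_on UNIV T = onorm T"
  by (simp add: onorm_on_def onorm_def)

end

theory Submission
  imports Defs
begin

text \<open>
  Put \<open>p = P\<^bsub>M\<^esub> x\<close> and \<open>z = Z p\<close>. The vector \<open>w = p - z\<close> lies in \<open>L\<close> because \<open>C p = D z\<close>, so the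
  \<open>N\<^sup>\<bottom>\<close>-component of \<open>T w\<close> vanishes and \<open>T w = A p - B z\<close>, which is the Schur complement at \<open>x\<close>.
  Since \<open>p\<close> and \<open>z\<close> are orthogonal, everything reduces to \<open>\<parallel>z\<parallel> \<le> \<lambda> \<parallel>p\<parallel>\<close>: then
  \<open>\<parallel>w\<parallel>\<^sup>2 = \<parallel>p\<parallel>\<^sup>2 + \<parallel>z\<parallel>\<^sup>2 \<le> (1 + \<lambda>\<^sup>2) \<parallel>x\<parallel>\<^sup>2\<close>, and both bounds follow by estimating \<open>\<parallel>T w\<parallel>\<close>.

  The bound on \<open>z\<close> is where complementability enters. Scaling the inclusion of balls shows that
  \<open>C p = D v\<close> has a solution \<open>v\<close> in \<open>M\<^sup>\<bottom>\<close> with \<open>\<parallel>v\<parallel> \<le> \<lambda> \<parallel>p\<parallel>\<close>, and the Douglas reduced solution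
  picks among all solutions the one orthogonal to the kernel of \<open>D\<close>, which is the shortest
  (\<open>douglas_solution_properties\<close>).

  Since \<open>orth_proj\<close> and \<open>douglas_solution\<close> are definite descriptions, they say something only once
  existence and uniqueness are known. Both come down to the projection theorem
  (\<open>orth_proj_properties\<close>), obtained from the parallelogram law and completeness.
\<close>

section \<open>Geometry of Hilbert spaces over the two scalar fields\<close>

lemma rc_conj_0 [simp]: "rc_conj 0 = (0::'k::rc_field)"
  using rc_conj_add[of 0 "0::'k"] by simp

lemma rc_conj_of_real: "rc_conj (of_real r) = (of_real r :: 'k::rc_field)"
proof (cases "r = 0")
  case False
  have "of_real r * rc_conj (of_real r :: 'k) = of_real r * of_real r"
    using mult_rc_conj[of "of_real r :: 'k"] by (simp add: power2_eq_square flip: of_real_mult)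
  with False show ?thesis by simp
qed simp

context hilbert_space
begin

lemma ip_zero_left [simp]: "ip 0 y = 0"
  using ip_add_left[of 0 0 y] by simp

lemma ip_zero_right [simp]: "ip y 0 = 0"
  using ip_commute[of y 0] by simp

lemma ip_add_right: "ip x (y + z) = ip x y + ip x z"
  unfolding ip_commute[of x] by (simp add: ip_add_left rc_conj_add)

lemma ip_smul_right: "ip x (smul c y) = rc_conj c * ip x y"
  unfolding ip_commute[of x] by (simp add: ip_smul_left rc_conj_mult)

lemma ip_diff_left: "ip (x - y) z = ip x z - ip y z"
  using ip_add_left[of "x - y" y z] by simp

lemma ip_diff_right: "ip z (x - y) = ip z x - ip z y"
  using ip_add_right[of z "x - y" y] by simp

lemma ip_eq_0_commute: "ip x y = 0 \<Longrightarrow> ip y x = 0"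
  using ip_commute[of y x] by simp

lemma ip_self_eq_0: "ip x x = 0 \<longleftrightarrow> x = 0"
  by (simp add: ip_self)

lemma pythagoras:
  assumes "ip x y = 0"
  shows "(norm (x + y))\<^sup>2 = (norm x)\<^sup>2 + (norm y)\<^sup>2"
proof -
  have "ip (x + y) (x + y) = ip x x + ip y y"
    using assms ip_eq_0_commute[OF assms] by (simp add: ip_add_left ip_add_right)
  then have "(of_real ((norm (x + y))\<^sup>2) :: 'k) = of_real ((norm x)\<^sup>2 + (norm y)\<^sup>2)"
    unfolding ip_self by simp
  then show ?thesis by (simp only: of_real_eq_iff)
qed

lemma parallelogram:
  fixes x y :: 'a
  shows "(norm (x + y))\<^sup>2 + (norm (x - y))\<^sup>2 = 2 * (norm x)\<^sup>2 + 2 * (norm y)\<^sup>2"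
proof -
  have "ip (x + y) (x + y) + ip (x - y) (x - y) = (ip x x + ip x x) + (ip y y + ip y y)"
    by (simp add: ip_add_left ip_add_right ip_diff_left ip_diff_right)
  then have "(of_real ((norm (x + y))\<^sup>2 + (norm (x - y))\<^sup>2) :: 'k)
      = of_real ((norm x)\<^sup>2 + (norm x)\<^sup>2 + ((norm y)\<^sup>2 + (norm y)\<^sup>2))"
    unfolding ip_self by simp
  then show ?thesis by (simp only: of_real_eq_iff)
qed

text \<open>
  Splitting off from \<open>u\<close> its component along \<open>w\<close>, with \<open>c = \<langle>u, w\<rangle> / \<parallel>w\<parallel>\<^sup>2\<close>. This one identity yields
  both the Cauchy-Schwarz inequality and the orthogonality of a nearest-point residual.
\<close>

lemma norm_split_along:
  fixes u w :: "'a"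
  assumes "w \<noteq> 0"
  defines "c \<equiv> ip u w / of_real ((norm w)\<^sup>2)"
  shows "(norm u)\<^sup>2 = (norm (u - smul c w))\<^sup>2 + (norm (smul c w))\<^sup>2"
proof -
  have "ip (u - smul c w) w = 0"
    using assms by (simp add: ip_diff_left ip_smul_left ip_self)
  then have "ip (u - smul c w) (smul c w) = 0"
    by (simp add: ip_smul_right)
  from pythagoras[OF this] show ?thesis by simp
qed

lemma norm_smul: "norm (smul c x) = norm c * norm x"
proof -
  have "(of_real ((norm (smul c x))\<^sup>2) :: 'k) = (c * rc_conj c) * ip x x"
    unfolding ip_self[symmetric] by (simp add: ip_smul_left ip_smul_right)
  also have "\<dots> = of_real ((norm c * norm x)\<^sup>2)"
    unfolding mult_rc_conj ip_self by (simp add: power_mult_distrib)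
  finally have "(norm (smul c x))\<^sup>2 = (norm c * norm x)\<^sup>2"
    by (simp only: of_real_eq_iff)
  then show ?thesis by (rule power2_eq_imp_eq) simp_all
qed

lemma cauchy_schwarz: "norm (ip u w) \<le> norm u * norm w"
proof (cases "w = 0")
  case False
  define c where "c = ip u w / of_real ((norm w)\<^sup>2)"
  have "(norm (smul c w))\<^sup>2 \<le> (norm u)\<^sup>2"
    using norm_split_along[OF False, of u] by (simp add: c_def)
  then have "norm c * norm w \<le> norm u"
    using power2_le_imp_le by (auto simp: norm_smul)
  moreover have "norm c = norm (ip u w) / (norm w)\<^sup>2"
    by (simp add: c_def norm_divide norm_power)
  then have "norm c * norm w = norm (ip u w) / norm w"
    using False by (simp add: power2_eq_square)
  ultimately have "norm (ip u w) / norm w \<le> norm u" by simp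
  then show ?thesis using False by (simp add: pos_divide_le_eq)
qed simp

lemma bounded_linear_ip_right: "bounded_linear (ip x)"
proof (rule bounded_linear_intro)
  show "ip x (r *\<^sub>R y) = r *\<^sub>R ip x y" for r y
    by (simp add: ip_smul_right rc_conj_of_real scaleR_conv_of_real flip: smul_of_real)
  show "norm (ip x y) \<le> norm y * norm x" for y
    using cauchy_schwarz[of x y] by (simp add: mult.commute)
qed (rule ip_add_right)

lemma subspace_scaleR: "subspace W \<Longrightarrow> x \<in> W \<Longrightarrow> r *\<^sub>R x \<in> W"
  using subspace_scale[of W x "of_real r"] by (simp add: smul_of_real)

lemma closed_subspace_orth_compl: "closed_subspace smul (orth_compl ip W)"
proof -
  have "closed {y. ip x y = 0}" for x
    using bounded_linear_ip_right[of x]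
    by (intro closed_Collect_eq) (auto intro: bounded_linear.continuous_on)
  moreover have "orth_compl ip W = (\<Inter>x\<in>W. {y. ip x y = 0})"
    by (auto simp: orth_compl_def)
  ultimately have "closed (orth_compl ip W)" by (auto intro!: closed_INT)
  moreover have "subspace (orth_compl ip W)"
    by (auto simp: subspace_def orth_compl_def ip_add_right ip_smul_right)
  ultimately show ?thesis by (simp add: closed_subspace_def)
qed

lemma orth_compl_orthD: "x \<in> W \<Longrightarrow> y \<in> orth_compl ip W \<Longrightarrow> ip x y = 0"
  by (simp add: orth_compl_def)

lemma subset_orth_compl_orth_compl: "W \<subseteq> orth_compl ip (orth_compl ip W)"
  by (auto simp: orth_compl_def dest: ip_eq_0_commute)

lemma orth_compl_inter: "x \<in> W \<Longrightarrow> x \<in> orth_compl ip W \<Longrightarrow> x = 0"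
  using ip_self_eq_0 by (auto simp: orth_compl_def)

text \<open>
  By the parallelogram law any two points of \<open>W\<close> that almost realise the distance to \<open>x\<close> are close to
  each other, as their midpoint cannot do better than the infimum. Hence the sets of almost
  minimisers have diameters tending to zero, and completeness gives a common point.
\<close>

lemma nearest_point_exists:
  assumes "closed_subspace smul W"
  shows "\<exists>p\<in>W. \<forall>w\<in>W. norm (x - p) \<le> norm (x - w)"
proof -
  have sub: "subspace W" and cl: "closed W"
    using assms by (auto simp: closed_subspace_def)
  define d where "d = (INF w\<in>W. (norm (x - w))\<^sup>2)"
  have bdd: "bdd_below ((\<lambda>w. (norm (x - w))\<^sup>2) ` W)"
    by (intro bdd_belowI2[of _ 0]) simp
  have low: "d \<le> (norm (x - w))\<^sup>2" if "w \<in> W" for w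
    unfolding d_def using bdd that by (rule cINF_lower)
  have ne: "W \<noteq> {}" using subspace_0[OF sub] by auto
  define S where "S n = {w \<in> W. (norm (x - w))\<^sup>2 \<le> d + 1 / Suc n}" for n
  have close: "(norm (v - w))\<^sup>2 \<le> 4 / Suc n" if "v \<in> S n" "w \<in> S n" for v w n
  proof -
    have "(1/2) *\<^sub>R (v + w) \<in> W"
      using that sub by (intro subspace_scaleR subspace_add) (auto simp: S_def)
    then have "d \<le> (norm (x - (1/2) *\<^sub>R (v + w)))\<^sup>2" by (rule low)
    moreover have "(x - v) + (x - w) = 2 *\<^sub>R (x - (1/2) *\<^sub>R (v + w))"
      by (simp add: algebra_simps scaleR_2)
    ultimately have "4 * d \<le> (norm ((x - v) + (x - w)))\<^sup>2"
      by (simp add: power_mult_distrib)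
    moreover have "norm ((x - v) - (x - w)) = norm (v - w)"
      by (simp add: norm_minus_commute)
    ultimately have "(norm (v - w))\<^sup>2 \<le> 2 * (norm (x - v))\<^sup>2 + 2 * (norm (x - w))\<^sup>2 - 4 * d"
      using parallelogram[of "x - v" "x - w"] by simp
    then show ?thesis using that by (simp add: S_def)
  qed
  obtain p where p: "\<And>n. p \<in> S n"
  proof (rule decreasing_closed_nest[of S])
    show "closed (S n)" for n
    proof -
      have "S n = W \<inter> {w. (norm (x - w))\<^sup>2 \<le> d + 1 / Suc n}" by (auto simp: S_def)
      moreover have "closed {w. (norm (x - w))\<^sup>2 \<le> d + 1 / Suc n}"
        by (intro closed_Collect_le continuous_intros)
      ultimately show ?thesis using cl by auto
    qed
    show "S n \<noteq> {}" for n
    proof -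
      have "d < d + 1 / Suc n" by simp
      then obtain w where "w \<in> W" "(norm (x - w))\<^sup>2 < d + 1 / Suc n"
        unfolding d_def using cINF_less_iff[OF ne bdd] by blast
      then show ?thesis by (auto simp: S_def)
    qed
    show "S n \<subseteq> S m" if "m \<le> n" for m n
    proof -
      have "1 / real (Suc n) \<le> 1 / Suc m" using that by (simp add: frac_le)
      then show ?thesis by (auto simp: S_def)
    qed
    show "\<exists>n. \<forall>v\<in>S n. \<forall>w\<in>S n. dist v w < e" if "e > 0" for e
    proof -
      obtain n where n: "inverse (real (Suc n)) < e\<^sup>2 / 4"
        using reals_Archimedean[of "e\<^sup>2 / 4"] \<open>e > 0\<close> by (metis divide_pos_pos zero_less_numeral zero_less_power)
      have "dist v w < e" if "v \<in> S n" "w \<in> S n" for v w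
      proof -
        have "(norm (v - w))\<^sup>2 < e\<^sup>2"
          using close[OF that] n by (simp add: inverse_eq_divide del: of_nat_Suc)
        then show ?thesis using \<open>e > 0\<close> by (simp add: dist_norm power2_less_imp_less)
      qed
      then show ?thesis by blast
    qed
  qed blast
  have opt: "(norm (x - p))\<^sup>2 \<le> d"
  proof (rule field_le_epsilon)
    fix e :: real assume "e > 0"
    then obtain n where "inverse (real (Suc n)) < e" using reals_Archimedean by blast
    then show "(norm (x - p))\<^sup>2 \<le> d + e"
      using p[of n] by (simp add: S_def inverse_eq_divide del: of_nat_Suc)
  qed
  have "norm (x - p) \<le> norm (x - w)" if "w \<in> W" for w
    using order_trans[OF opt low[OF that]] norm_ge_zero by (rule power2_le_imp_le)
  then show ?thesis using p[of 0] by (auto simp: S_def)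
qed

lemma nearest_point_residual_orth:
  assumes sub: "subspace W" and p: "p \<in> W" "\<forall>w\<in>W. norm (x - p) \<le> norm (x - w)"
  shows "x - p \<in> orth_compl ip W"
proof -
  have "ip (x - p) w = 0" if w: "w \<in> W" for w
  proof (cases "w = 0")
    case False
    define c where "c = ip (x - p) w / of_real ((norm w)\<^sup>2)"
    have "p + smul c w \<in> W"
      using sub p w by (intro subspace_add subspace_scale)
    then have "norm (x - p) \<le> norm (x - p - smul c w)"
      using p by (metis diff_diff_add)
    then have "(norm (x - p))\<^sup>2 \<le> (norm (x - p - smul c w))\<^sup>2"
      by (rule power_mono) simp
    then have "smul c w = 0"
      using norm_split_along[OF False, of "x - p"] by (simp add: c_def)
    then show ?thesis using False by (simp add: c_def)
  qed simp
  then show ?thesis by (auto simp: orth_compl_def dest: ip_eq_0_commute)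
qed

lemma orth_proj_unique:
  assumes sub: "subspace W" and p: "p \<in> W" "x - p \<in> orth_compl ip W"
  shows "orth_proj ip W x = p"
  unfolding orth_proj_def
proof (rule the_equality)
  fix q assume q: "q \<in> W \<and> x - q \<in> orth_compl ip W"
  have "subspace (orth_compl ip W)"
    using closed_subspace_orth_compl by (simp add: closed_subspace_def)
  then have "(x - p) - (x - q) \<in> orth_compl ip W"
    using p q by (blast intro: subspace_diff)
  moreover have "q - p \<in> W" using p q sub by (blast intro: subspace_diff)
  ultimately have "q - p = 0" by (intro orth_compl_inter[of _ W]) simp_all
  then show "q = p" by simp
qed (use p in blast)

lemma orth_proj_properties:
  assumes "closed_subspace smul W"
  shows "orth_proj ip W x \<in> W" and "x - orth_proj ip W x \<in> orth_compl ip W"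
proof -
  have sub: "subspace W" using assms by (simp add: closed_subspace_def)
  obtain p where p: "p \<in> W" "\<forall>w\<in>W. norm (x - p) \<le> norm (x - w)"
    using nearest_point_exists[OF assms, of x] by blast
  note r = nearest_point_residual_orth[OF sub p]
  show "orth_proj ip W x \<in> W" "x - orth_proj ip W x \<in> orth_compl ip W"
    using p r orth_proj_unique[OF sub p(1) r] by auto
qed

lemma norm_orth_proj_pythagoras:
  assumes "closed_subspace smul W"
  shows "(norm x)\<^sup>2 = (norm (orth_proj ip W x))\<^sup>2 + (norm (x - orth_proj ip W x))\<^sup>2"
proof -
  have "ip (orth_proj ip W x) (x - orth_proj ip W x) = 0"
    using orth_proj_properties[OF assms] by (rule orth_compl_orthD)
  from pythagoras[OF this] show ?thesis by simp
qed

lemma norm_orth_proj_le: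
  assumes "closed_subspace smul W"
  shows "norm (orth_proj ip W x) \<le> norm x"
  by (rule power2_le_imp_le) (use norm_orth_proj_pythagoras[OF assms, of x] in simp_all)

lemma norm_orth_residual_le:
  assumes "closed_subspace smul W"
  shows "norm (x - orth_proj ip W x) \<le> norm x"
  by (rule power2_le_imp_le) (use norm_orth_proj_pythagoras[OF assms, of x] in simp_all)

lemma orth_proj_add:
  assumes W: "closed_subspace smul W"
  shows "orth_proj ip W (x + y) = orth_proj ip W x + orth_proj ip W y"
proof (rule orth_proj_unique)
  show sub: "subspace W" using W by (simp add: closed_subspace_def)
  show "orth_proj ip W x + orth_proj ip W y \<in> W"
    using orth_proj_properties[OF W] sub by (intro subspace_add)
  have "(x - orth_proj ip W x) + (y - orth_proj ip W y) \<in> orth_compl ip W"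
    using orth_proj_properties[OF W] closed_subspace_orth_compl[of W]
    by (intro subspace_add) (auto simp: closed_subspace_def)
  then show "x + y - (orth_proj ip W x + orth_proj ip W y) \<in> orth_compl ip W"
    by (simp add: algebra_simps)
qed

lemma orth_proj_smul:
  assumes W: "closed_subspace smul W"
  shows "orth_proj ip W (smul c x) = smul c (orth_proj ip W x)"
proof (rule orth_proj_unique)
  show sub: "subspace W" using W by (simp add: closed_subspace_def)
  show "smul c (orth_proj ip W x) \<in> W"
    using orth_proj_properties[OF W] sub by (intro subspace_scale)
  have "smul c (x - orth_proj ip W x) \<in> orth_compl ip W"
    using orth_proj_properties[OF W] closed_subspace_orth_compl[of W]
    by (intro subspace_scale) (auto simp: closed_subspace_def)
  then show "smul c x - smul c (orth_proj ip W x) \<in> orth_compl ip W"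
    by (simp add: scale_right_diff_distrib)
qed

lemma orth_proj_orth_compl:
  assumes W: "closed_subspace smul W"
  shows "orth_proj ip (orth_compl ip W) x = x - orth_proj ip W x"
proof (rule orth_proj_unique)
  show "subspace (orth_compl ip W)"
    using closed_subspace_orth_compl by (simp add: closed_subspace_def)
  show "x - orth_proj ip W x \<in> orth_compl ip W" by (rule orth_proj_properties[OF W])
  show "x - (x - orth_proj ip W x) \<in> orth_compl ip (orth_compl ip W)"
    using orth_proj_properties(1)[OF W] subset_orth_compl_orth_compl by auto
qed

end

section \<open>Bounded operators between subspaces and reduced solutions\<close>

lemma bounded_opsD:
  assumes "S \<in> bounded_ops s1 s2 W V"
  shows "x \<in> W \<Longrightarrow> S x \<in> V"
    and "x \<in> W \<Longrightarrow> y \<in> W \<Longrightarrow> S (x + y) = S x + S y"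
    and "x \<in> W \<Longrightarrow> S (s1 c x) = s2 c (S x)"
    and "\<exists>K. \<forall>x\<in>W. norm (S x) \<le> K * norm x"
    and "x \<notin> W \<Longrightarrow> S x = undefined"
  using assms by (auto simp: bounded_ops_def PiE_def extensional_def)

lemma bounded_ops_diff:
  assumes "hilbert_space s1 ip1" "module.subspace s1 W" "S \<in> bounded_ops s1 s2 W V"
    and "x \<in> W" "y \<in> W"
  shows "S (x - y) = S x - S y"
proof -
  interpret hilbert_space s1 ip1 by fact
  have "x - y \<in> W" using assms by (intro subspace_diff)
  then show ?thesis using bounded_opsD(2)[OF assms(3), of "x - y" y] assms(5) by simp
qed

lemma bounded_ops_zero:
  assumes "hilbert_space s1 ip1" "module.subspace s1 W" "S \<in> bounded_ops s1 s2 W V"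
  shows "S 0 = 0"
proof -
  interpret hilbert_space s1 ip1 by fact
  have "0 \<in> W" using assms by (intro subspace_0)
  then show ?thesis using bounded_ops_diff[OF assms, of 0 0] by simp
qed

lemma closed_subspace_kernel:
  assumes H1: "hilbert_space s1 ip1" and H2: "hilbert_space s2 ip2"
    and W: "closed_subspace s1 W" and S: "S \<in> bounded_ops s1 s2 W V"
  shows "closed_subspace s1 {z \<in> W. S z = 0}"
proof -
  interpret H1: hilbert_space s1 ip1 by fact
  interpret H2: hilbert_space s2 ip2 by fact
  have sub: "H1.subspace W" and cl: "closed W"
    using W by (auto simp: closed_subspace_def)
  note S0 = bounded_ops_zero[OF H1 sub S]
  obtain K where K: "\<And>x. x \<in> W \<Longrightarrow> norm (S x) \<le> K * norm x"
    using bounded_opsD(4)[OF S] by blast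
  have "closed {z \<in> W. S z = 0}"
    unfolding closed_sequential_limits
  proof (intro allI impI)
    fix f z assume *: "(\<forall>n. f n \<in> {z \<in> W. S z = 0}) \<and> f \<longlonglongrightarrow> z"
    then have fW: "\<And>n. f n \<in> W" and zW: "z \<in> W"
      using cl closed_sequentially by auto
    have bound: "norm (S z) \<le> K * norm (z - f n)" for n
      using K[of "z - f n"] bounded_ops_diff[OF H1 sub S zW fW[of n]] *
        H1.subspace_diff[OF sub zW fW[of n]] by auto
    have "(\<lambda>n. K * norm (z - f n)) \<longlonglongrightarrow> K * norm (z - z)"
      using * by (intro tendsto_intros) auto
    then have "norm (S z) \<le> K * norm (z - z)"
      using bound by (intro LIMSEQ_le_const) auto
    then show "z \<in> {z \<in> W. S z = 0}" using zW by simp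
  qed
  moreover have "H1.subspace {z \<in> W. S z = 0}"
    using sub S0 bounded_opsD(2,3)[OF S]
    by (auto simp: H1.subspace_def)
  ultimately show ?thesis by (simp add: closed_subspace_def)
qed

text \<open>
  Subtracting from a preimage its component in the kernel does not change its image and, by
  Pythagoras, does not increase its norm. This is why the reduced solution is the shortest one.
\<close>

lemma reduced_preimage_exists:
  assumes H1: "hilbert_space s1 ip1" and H2: "hilbert_space s2 ip2"
    and W: "closed_subspace s1 W" and S: "S \<in> bounded_ops s1 s2 W V"
    and w: "w \<in> W"
  shows "\<exists>z\<in>W \<inter> orth_compl ip1 {z \<in> W. S z = 0}. S z = S w \<and> norm z \<le> norm w"
proof -
  interpret H1: hilbert_space s1 ip1 by fact
  have sub: "H1.subspace W" using W by (simp add: closed_subspace_def)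
  note K = closed_subspace_kernel[OF H1 H2 W S]
  let ?q = "orth_proj ip1 {z \<in> W. S z = 0} w"
  have q: "?q \<in> W" "S ?q = 0" using H1.orth_proj_properties(1)[OF K, of w] by auto
  have "w - ?q \<in> W" using sub w q by (intro H1.subspace_diff)
  moreover have "S (w - ?q) = S w" using bounded_ops_diff[OF H1 sub S w q(1)] q by simp
  ultimately show ?thesis
    using H1.orth_proj_properties(2)[OF K, of w] H1.norm_orth_residual_le[OF K, of w] by blast
qed

lemma reduced_preimage_unique:
  assumes H1: "hilbert_space s1 ip1"
    and sub: "module.subspace s1 W" and S: "S \<in> bounded_ops s1 s2 W V"
    and x: "x \<in> W \<inter> orth_compl ip1 {z \<in> W. S z = 0}"
    and y: "y \<in> W \<inter> orth_compl ip1 {z \<in> W. S z = 0}"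
    and eq: "S x = S y"
  shows "x = y"
proof -
  interpret H1: hilbert_space s1 ip1 by fact
  have "x - y \<in> {z \<in> W. S z = 0}"
    using x y eq bounded_ops_diff[OF H1 sub S, of x y] H1.subspace_diff[OF sub] by auto
  moreover have "x - y \<in> orth_compl ip1 {z \<in> W. S z = 0}"
    using x y H1.closed_subspace_orth_compl
    by (intro H1.subspace_diff) (auto simp: closed_subspace_def)
  ultimately have "x - y = 0" by (rule H1.orth_compl_inter)
  then show ?thesis by simp
qed

text \<open>
  The half of Douglas' theorem in which a uniform bound on preimages is given rather than derived
  from the inclusion of ranges by the closed graph theorem. Taking reduced preimages pointwise
  is automatically linear, by their uniqueness.
\<close>

lemma douglas_solution_properties:
  assumes HU: "hilbert_space sU ipU" and HW: "hilbert_space sW ipW"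
    and H2: "hilbert_space s2 ip2"
    and U: "module.subspace sU U" and W: "closed_subspace sW W"
    and A: "A \<in> bounded_ops sU s2 U V" and B: "B \<in> bounded_ops sW s2 W V"
    and pre: "\<And>u. u \<in> U \<Longrightarrow> \<exists>w\<in>W. A u = B w \<and> norm w \<le> c * norm u"
  defines "Z \<equiv> douglas_solution sU sW ipW U W A B"
  assumes u: "u \<in> U"
  shows "Z u \<in> W" and "A u = B (Z u)" and "norm (Z u) \<le> c * norm u"
proof -
  interpret HU: hilbert_space sU ipU by fact
  interpret HW: hilbert_space sW ipW by fact
  have subW: "HW.subspace W" using W by (simp add: closed_subspace_def)
  let ?R = "W \<inter> orth_compl ipW {z \<in> W. B z = 0}"
  have R: "HW.subspace ?R"
    using subW HW.closed_subspace_orth_compl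
    by (intro HW.subspace_inter) (auto simp: closed_subspace_def)
  note uniq = reduced_preimage_unique[OF HW subW B]
  have "\<exists>z\<in>?R. A u = B z \<and> norm z \<le> c * norm u" if uU: "u \<in> U" for u
  proof -
    obtain w where w: "w \<in> W" "A u = B w" "norm w \<le> c * norm u" using pre[OF uU] by blast
    obtain z where z: "z \<in> ?R" "B z = B w" "norm z \<le> norm w"
      using reduced_preimage_exists[OF HW H2 W B w(1)] by auto
    have "A u = B z" "norm z \<le> c * norm u" using w z by auto
    then show ?thesis using z(1) by blast
  qed
  then obtain X0 where X0: "\<And>u. u \<in> U \<Longrightarrow> X0 u \<in> ?R \<and> A u = B (X0 u) \<and> norm (X0 u) \<le> c * norm u"
    by metis
  define X where "X = restrict X0 U"
  have X: "X u \<in> ?R" "A u = B (X u)" "norm (X u) \<le> c * norm u" if "u \<in> U" for u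
    using X0[OF that] that by (simp_all add: X_def)
  have Xadd: "X (u + v) = X u + X v" if uv: "u \<in> U" "v \<in> U" for u v
  proof (rule uniq)
    have uv': "u + v \<in> U" using U uv by (rule HU.subspace_add)
    show "X (u + v) \<in> ?R" using X(1)[OF uv'] .
    show "X u + X v \<in> ?R" using X(1) uv by (intro HW.subspace_add[OF R])
    have "X u \<in> W" "X v \<in> W" using X(1) uv by auto
    then have "B (X u + X v) = A u + A v"
      using bounded_opsD(2)[OF B] X(2) uv by simp
    also have "\<dots> = B (X (u + v))"
      using bounded_opsD(2)[OF A uv] X(2)[OF uv'] by simp
    finally show "B (X (u + v)) = B (X u + X v)" by simp
  qed
  have Xsmul: "X (sU a u) = sW a (X u)" if v: "u \<in> U" for a u
  proof (rule uniq)
    have v': "sU a u \<in> U" using U v by (rule HU.subspace_scale)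
    show "X (sU a u) \<in> ?R" using X(1)[OF v'] .
    show "sW a (X u) \<in> ?R" using X(1) v by (intro HW.subspace_scale[OF R])
    have "X u \<in> W" using X(1) v by auto
    then have "B (sW a (X u)) = s2 a (A u)"
      using bounded_opsD(3)[OF B] X(2)[OF v] by simp
    also have "\<dots> = B (X (sU a u))"
      using bounded_opsD(3)[OF A v] X(2)[OF v'] by metis
    finally show "B (X (sU a u)) = B (sW a (X u))" by simp
  qed
  have "Z = X"
    unfolding Z_def douglas_solution_def
  proof (rule the_equality, intro conjI)
    show "X \<in> bounded_ops sU sW U W"
    proof -
      have "X \<in> U \<rightarrow>\<^sub>E W" using X(1) by (auto simp: X_def)
      moreover have "\<exists>K. \<forall>u\<in>U. norm (X u) \<le> K * norm u" using X(3) by blast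
      ultimately show ?thesis using Xadd Xsmul by (simp add: bounded_ops_def)
    qed
    show "\<forall>u\<in>U. A u = B (X u)" "X ` U \<subseteq> ?R" using X by auto
  next
    fix Y assume Y: "Y \<in> bounded_ops sU sW U W \<and> (\<forall>u\<in>U. A u = B (Y u)) \<and> Y ` U \<subseteq> ?R"
    show "Y = X"
    proof
      fix u
      show "Y u = X u"
      proof (cases "u \<in> U")
        case True
        show ?thesis
        proof (rule uniq)
          show "Y u \<in> ?R" using Y True by blast
          show "X u \<in> ?R" using X(1)[OF True] .
          show "B (Y u) = B (X u)" using Y X(2) True by metis
        qed
      next
        case False
        have "Y u = undefined" using Y bounded_opsD(5) False by blast
        then show ?thesis using False by (simp add: X_def)
      qed
    qed
  qed
  then show "Z u \<in> W" "A u = B (Z u)" "norm (Z u) \<le> c * norm u" using X[OF u] by auto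
qed

section \<open>Blocks of an operator and the Schur complement\<close>

lemma op_block_bounded_ops:
  assumes H2: "hilbert_space s2 ip2" and V: "closed_subspace s2 V"
    and T: "T \<in> bounded_ops s1 s2 UNIV UNIV"
    and H1: "hilbert_space s1 ip1" and W: "module.subspace s1 W"
  shows "op_block ip2 W V T \<in> bounded_ops s1 s2 W V"
proof -
  interpret H1: hilbert_space s1 ip1 by fact
  interpret H2: hilbert_space s2 ip2 by fact
  obtain K where "\<And>x. norm (T x) \<le> K * norm x" using bounded_opsD(4)[OF T] by auto
  then have "norm (orth_proj ip2 V (T x)) \<le> K * norm x" for x
    using H2.norm_orth_proj_le[OF V] order_trans by blast
  then show ?thesis
    using bounded_opsD(2,3)[OF T] H1.subspace_add[OF W] H1.subspace_scale[OF W]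
      H2.orth_proj_add[OF V] H2.orth_proj_smul[OF V] H2.orth_proj_properties(1)[OF V]
    by (auto simp: bounded_ops_def op_block_def)
qed

text \<open>
  An inclusion between images of unit balls is a solvability statement for unit vectors; by
  homogeneity it becomes a norm bound on preimages of arbitrary vectors.
\<close>

lemma preimage_bound_of_ball_inclusion:
  assumes H1: "hilbert_space s1 ip1" and H2: "hilbert_space s2 ip2"
    and U: "module.subspace s1 U" and W: "module.subspace s1 W"
    and C: "C \<in> bounded_ops s1 s2 U V" and D: "D \<in> bounded_ops s1 s2 W V"
    and balls: "C ` unit_ball U \<subseteq> (\<lambda>v. l *\<^sub>R v) ` D ` unit_ball W" and "l \<ge> 0"
    and u: "u \<in> U"
  shows "\<exists>w\<in>W. C u = D w \<and> norm w \<le> l * norm u"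
proof (cases "u = 0")
  case True
  interpret H1: hilbert_space s1 ip1 by fact
  show ?thesis
    using True bounded_ops_zero[OF H1 U C] bounded_ops_zero[OF H1 W D] H1.subspace_0[OF W]
    by (intro bexI[of _ 0]) auto
next
  case False
  interpret H1: hilbert_space s1 ip1 by fact
  interpret H2: hilbert_space s2 ip2 by fact
  have scale: "S (r *\<^sub>R x) = r *\<^sub>R S x" if "S \<in> bounded_ops s1 s2 X V" "x \<in> X" for S X r x
    using bounded_opsD(3)[OF that, of "of_real r"] by (simp add: H1.smul_of_real H2.smul_of_real)
  define e where "e = (1 / norm u) *\<^sub>R u"
  have e: "e \<in> unit_ball U"
    using False H1.subspace_scaleR[OF U u] by (simp add: e_def unit_ball_def)
  then obtain v where v: "v \<in> W" "norm v \<le> 1" "C e = l *\<^sub>R D v"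
    using balls by (fastforce simp: unit_ball_def)
  have "u = norm u *\<^sub>R e" using False by (simp add: e_def)
  then have "C u = norm u *\<^sub>R C e" using scale[OF C, of e "norm u"] e by (simp add: unit_ball_def)
  also have "\<dots> = D ((norm u * l) *\<^sub>R v)" using scale[OF D v(1)] v(3) by simp
  finally have "C u = D ((norm u * l) *\<^sub>R v)" .
  moreover have "norm ((norm u * l) *\<^sub>R v) \<le> l * norm u"
    using mult_left_mono[OF v(2), of "norm u * l"] \<open>l \<ge> 0\<close> by (simp add: mult.commute)
  ultimately show ?thesis using H1.subspace_scaleR[OF W v(1)] by blast
qed

text \<open>
  This turns the comparison of norms into a pointwise one. The single equation \<open>C p = D (Z p)\<close> both
  puts the witness \<open>p - Z p\<close> into the row kernel and makes \<open>T\<close> act on it through the first row only.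
\<close>

lemma schur_complement_factors_through_row_kernel:
  assumes H1: "hilbert_space smul1 ip1" and H2: "hilbert_space smul2 ip2"
    and M: "closed_subspace smul1 M" and N: "closed_subspace smul2 N"
    and T: "T \<in> bounded_ops smul1 smul2 UNIV UNIV"
    and "l > 0" and compl: "complementable ip1 ip2 M N l T"
  shows "\<exists>w\<in>row_kernel ip1 ip2 M N T.
    schur_complement smul1 ip1 ip2 M N T x = T w \<and> norm w \<le> sqrt (1 + l\<^sup>2) * norm x"
proof -
  interpret H1: hilbert_space smul1 ip1 by fact
  interpret H2: hilbert_space smul2 ip2 by fact
  define M' N' where "M' = orth_compl ip1 M" and "N' = orth_compl ip2 N"
  define A B where "A = op_block ip2 M N T" and "B = op_block ip2 M' N T"
  define C D where "C = op_block ip2 M N' T" and "D = op_block ip2 M' N' T"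
  define Z where "Z = douglas_solution smul1 smul1 ip1 M M' C D"
  define p z where "p = orth_proj ip1 M x" and "z = Z p"
  have M': "closed_subspace smul1 M'" and N': "closed_subspace smul2 N'"
    by (simp_all add: M'_def N'_def H1.closed_subspace_orth_compl H2.closed_subspace_orth_compl)
  have subM: "H1.subspace M" and subM': "H1.subspace M'"
    using M M' by (simp_all add: closed_subspace_def)
  have C: "C \<in> bounded_ops smul1 smul2 M N'" and D: "D \<in> bounded_ops smul1 smul2 M' N'"
    unfolding C_def D_def using op_block_bounded_ops[OF H2 N' T H1] subM subM' by auto
  have pM: "p \<in> M" unfolding p_def by (rule H1.orth_proj_properties[OF M])
  have balls: "C ` unit_ball M \<subseteq> (\<lambda>v. l *\<^sub>R v) ` D ` unit_ball M'"
    using compl unfolding complementable_def Let_def C_def D_def M'_def N'_def by blast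
  have pre: "\<exists>w\<in>M'. C u = D w \<and> norm w \<le> l * norm u" if "u \<in> M" for u
    using \<open>l > 0\<close> that
    by (intro preimage_bound_of_ball_inclusion[OF H1 H2 subM subM' C D balls]) auto
  have z: "z \<in> M'" "C p = D z" "norm z \<le> l * norm p"
    unfolding z_def Z_def
    using douglas_solution_properties[OF H1 H1 H2 subM M' C D pre pM] by auto
  define w where "w = p - z"
  have "w = p + (- z)" "- z \<in> M'" "C p + D (- z) = 0"
    using z bounded_ops_diff[OF H1 subM' D H1.subspace_0[OF subM'] z(1)]
      bounded_ops_zero[OF H1 subM' D] H1.subspace_neg[OF subM' z(1)]
    by (auto simp: w_def)
  then have wL: "w \<in> row_kernel ip1 ip2 M N T"
    using pM unfolding row_kernel_def Let_def M'_def N'_def C_def D_def by blast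
  have Tw: "T w = T p - T z"
    unfolding w_def by (rule bounded_ops_diff[OF H1 H1.subspace_UNIV T]) auto
  have "T p - orth_proj ip2 N (T p) = T z - orth_proj ip2 N (T z)"
    using z(1,2) pM H2.orth_proj_orth_compl[OF N]
    by (simp add: C_def D_def op_block_def N'_def)
  then have "A p - B z = T w"
    using pM z(1) by (simp add: A_def B_def op_block_def Tw algebra_simps)
  moreover have "schur_complement smul1 ip1 ip2 M N T x = A p - B z"
    unfolding schur_complement_def Let_def A_def B_def z_def Z_def p_def C_def D_def M'_def N'_def ..
  moreover have "norm w \<le> sqrt (1 + l\<^sup>2) * norm x"
  proof -
    have "ip1 p (- z) = 0"
      using pM H1.subspace_neg[OF subM' z(1)] unfolding M'_def by (rule H1.orth_compl_orthD)
    from H1.pythagoras[OF this] have "(norm w)\<^sup>2 = (norm p)\<^sup>2 + (norm z)\<^sup>2" by (simp add: w_def)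
    also have "\<dots> \<le> (norm p)\<^sup>2 + (l * norm p)\<^sup>2"
      using z(3) by (simp add: power_mono)
    also have "\<dots> = (1 + l\<^sup>2) * (norm p)\<^sup>2" by (simp add: algebra_simps)
    also have "\<dots> \<le> (1 + l\<^sup>2) * (norm x)\<^sup>2"
      using H1.norm_orth_proj_le[OF M, of x] by (intro mult_left_mono power_mono) (auto simp: p_def)
    finally have "(norm w)\<^sup>2 \<le> (sqrt (1 + l\<^sup>2) * norm x)\<^sup>2" by (simp add: power_mult_distrib)
    then show ?thesis by (rule power2_le_imp_le) simp
  qed
  ultimately show ?thesis using wL by auto
qed

lemma
  assumes T: "bounded_linear T"
  shows norm_le_onorm_on: "w \<in> L \<Longrightarrow> norm (T w) \<le> onorm_on L T * norm w"
    and onorm_on_nonneg: "L \<noteq> {} \<Longrightarrow> 0 \<le> onorm_on L T"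
    and onorm_on_le_onorm: "L \<noteq> {} \<Longrightarrow> onorm_on L T \<le> onorm T"
proof -
  have le: "norm (T w) / norm w \<le> onorm T" for w
    by (rule le_onorm[OF T])
  have upper: "norm (T w) / norm w \<le> onorm_on L T" if "w \<in> L" for w
    unfolding onorm_on_def using le that by (intro cSUP_upper bdd_aboveI2) auto
  show "norm (T w) \<le> onorm_on L T * norm w" if "w \<in> L"
  proof (cases "w = 0")
    case True
    then show ?thesis using T by (simp add: linear_simps)
  next
    case False
    then show ?thesis using upper[OF that] by (simp add: field_simps)
  qed
  show "0 \<le> onorm_on L T" if "L \<noteq> {}"
  proof -
    obtain w where "w \<in> L" using \<open>L \<noteq> {}\<close> by blast
    have "0 \<le> norm (T w) / norm w" by simp
    also have "\<dots> \<le> onorm_on L T" using \<open>w \<in> L\<close> by (rule upper)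
    finally show ?thesis .
  qed
  show "onorm_on L T \<le> onorm T" if "L \<noteq> {}"
    unfolding onorm_on_def using that le by (intro cSUP_least)
qed

theorem theorem3p4:
  fixes smul1 :: "'k::rc_field \<Rightarrow> 'a::banach \<Rightarrow> 'a"
    and ip1 :: "'a \<Rightarrow> 'a \<Rightarrow> 'k"
    and smul2 :: "'k \<Rightarrow> 'b::banach \<Rightarrow> 'b"
    and ip2 :: "'b \<Rightarrow> 'b \<Rightarrow> 'k"
    and M :: "'a set" and N :: "'b set"
    and T :: "'a \<Rightarrow> 'b" and l :: real
  assumes "hilbert_space smul1 ip1" and "hilbert_space smul2 ip2"
    and "closed_subspace smul1 M" and "closed_subspace smul2 N"
    and "T \<in> bounded_ops smul1 smul2 UNIV UNIV"
    and "l > 0"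
    and "complementable ip1 ip2 M N l T"
  shows "onorm (schur_complement smul1 ip1 ip2 M N T)
           \<le> sqrt (1 + l\<^sup>2) * onorm_on (row_kernel ip1 ip2 M N T) T
       \<and> onorm (schur_complement smul1 ip1 ip2 M N T) \<le> sqrt (1 + l\<^sup>2) * onorm T"
proof -
  let ?S = "schur_complement smul1 ip1 ip2 M N T"
  let ?L = "row_kernel ip1 ip2 M N T"
  let ?k = "sqrt (1 + l\<^sup>2)"
  have T: "bounded_linear T"
    using assms(5) bounded_ops_UNIV[OF assms(1,2)] by blast
  note factor = schur_complement_factors_through_row_kernel[OF assms]
  have ne: "?L \<noteq> {}" using factor by blast
  have "onorm ?S \<le> ?k * onorm_on ?L T"
  proof (rule onorm_bound)
    show "0 \<le> ?k * onorm_on ?L T" using onorm_on_nonneg[OF T ne] by simp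
    fix x
    obtain w where w: "w \<in> ?L" "?S x = T w" "norm w \<le> ?k * norm x" using factor by blast
    have "norm (?S x) \<le> onorm_on ?L T * norm w" using norm_le_onorm_on[OF T w(1)] w(2) by simp
    also have "\<dots> \<le> onorm_on ?L T * (?k * norm x)"
      using w(3) onorm_on_nonneg[OF T ne] by (rule mult_left_mono)
    finally show "norm (?S x) \<le> ?k * onorm_on ?L T * norm x" by (simp add: ac_simps)
  qed
  moreover have "?k * onorm_on ?L T \<le> ?k * onorm T"
    using onorm_on_le_onorm[OF T ne] by (intro mult_left_mono) simp_all
  ultimately show ?thesis by linarith
qed

end
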